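(* Let $G$ be an alternating dimap, let $e\in E(G)$ and let $\mu,\nu\in\{1,\omega,\omega^2\}$, where $\omega=\exp(2\pi i/3)$. Then $$G^{\mu}[\nu]e^{\mu} = (G[\mu\nu]e)^{\mu},$$ where $\mu\nu$ is the product of complex numbers, $G^{\mu}$ denotes the corresponding trial of $G$ (with $e^{\mu}$ the edge of $G^{\mu}$ corresponding to $e$), and $H[\nu]e$ denotes the $\nu$-reduction of $H$ by the edge $e$.
   Context: An \emph{alternating dimap} is a finite directed graph (loops and multiple edges allowed) without isolated vertices, 2-cell-embedded in a disjoint union of oriented surfaces (orientable 2-manifolds, one for each component), such that around each vertex the incident edges are directed alternately into and out of the vertex. The empty alternating dimap (no vertices, edges, faces) is allowed. All edges around a face go in the same direction; a face is a \emph{c-face} (clockwise) or \emph{a-face} (anticlockwise) accordingly. An \emph{in-star} is the set of all edges directed into some vertex. Each edge $e$ lies in exactly one c-face $C(e)$, one a-face $A(e)$ and one in-star $I(e)$. The \emph{left successor} (resp. \emph{right successor}) of $e$ is the next edge after $e$ going around $A(e)$ (resp. $C(e)$) in the direction of $e$. Let $\omega=\exp(2\pi i/3)$. The permutations $\sigma_1,\sigma_\omega,\sigma_{\omega^2}$ of $E(G)$ (also written $\sigma_{G,\mu}$) send $e$ to the next edge in clockwise order around $I(e)$, $A(e)$, $C(e)$ respectively (outgoing edges are skipped in going around an in-star). So the left successor of $e$ is $\sigma_\omega^{-1}(e)$ and the right successor is $\sigma_{\omega^2}(e)$. They satisfy $\sigma_1\sigma_\omega\sigma_{\omega^2}=\mathrm{id}$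 (rightmost applied first), and alternating dimaps correspond bijectively to triples of permutations of a finite set satisfying this identity; in-stars (vertices), a-faces and c-faces are the cycles of $\sigma_1,\sigma_\omega,\sigma_{\omega^2}$. Two alternating dimaps are equal when they have the same edge set and the same triple. \emph{Minor operations.} Let $e$ be an edge from $u$ to $v$. 1-reduction $G[1]e$ (contraction): if $e$ is not a loop, delete $e$ and identify its endpoints, preserving the order of edges and faces around vertices; if $e$ alone forms an a-face or a c-face, delete $e$; if $e$ is any other loop, with cyclic order of edge-ends around $v$ being $e$ (directed in)$,a_1,b_1,\ldots,a_k,b_k,e$ (directed out)$,c_1,d_1,\ldots,c_l,d_l$, delete $e$ and replace $v$ by two vertices $v_1,v_2$, with the ends $a_i,b_i$ reattached to $v_1$ and the ends $c_i,d_i$ to $v_2$, in the induced cyclic orders. $\omega$-reduction $G[\omega]e$: delete $e$ and, if the left successor $g$ of $e$ is not $e$ itself, change the tail of $g$ from $v$ to $u$ so that $g$ takes the place of $e,g$ in $A(e)$. $\omega^2$-reduction $G[\omega^2]e$: delete $e$ and, if the right successor $f$ of $e$ is not $e$ itself, change the tail of $f$ from $v$ to $u$ so that $f$ takes the place of $e,f$ in $C(e)$. A vertex left without edges disappears. Equivalently, writing $\pi\setminus e$ for the permutation of $E\setminus\{e\}$ obtained from $\pi$ by removing $e$ from its cycle: in $G[1]e$, $\sigma_\omega$ and $\sigma_{\omega^2}$ become $\sigma_\omega\setminus e$ and $\sigma_{\omega^2}\setminus e$; in $G[\omega]e$, $\sigma_1$ and $\sigma_\omega$ become $\sigma_1\setminus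 e$ and $\sigma_\omega\setminus e$; in $G[\omega^2]e$, $\sigma_1$ and $\sigma_{\omega^2}$ become $\sigma_1\setminus e$ and $\sigma_{\omega^2}\setminus e$; in each case the third permutation is determined by the product identity. \emph{Trial.} The trial $G^\omega$ of $G$ has one vertex $v_C$ for each c-face $C$ of $G$. For each edge $e$ of $G$, with left successor $f$ (so $e,f$ are consecutive in an a-face), $G^\omega$ has an edge $e^\omega$ from $v_{C(f)}$ to $v_{C(e)}$, drawn so that it crosses $f$ and then $e$. The c-faces, a-faces and in-stars of $G^\omega$ correspond under $e\mapsto e^\omega$ to the a-faces, in-stars and c-faces, respectively, of $G$; in permutation terms, $\sigma_{G^\omega,\omega}(e^\omega)=\sigma_{G,1}(e)^\omega$, $\sigma_{G^\omega,\omega^2}(e^\omega)=\sigma_{G,\omega}(e)^\omega$, $\sigma_{G^\omega,1}(e^\omega)=\sigma_{G,\omega^2}(e)^\omega$. That is, if $G$ is represented by $(\sigma_1,\sigma_\omega,\sigma_{\omega^2})$ then $G^\omega$ is represented by $(\sigma_\omega,\sigma_{\omega^2},\sigma_1)$ wait-free up to the relabelling $e\mapsto e^\omega$ as specified by: the in-star, a-face and c-face permutations of $G^\omega$ are $\sigma_{G,\omega^2},\sigma_{G,1},\sigma_{G,\omega}$ respectively, as in the three displayed identities, which are the ones to be used. Put $G^1=G$, $e^1=e$, $G^{\omega^2}=(G^\omega)^\omega$, $e^{\omega^2}=(e^\omega)^\omega$. *)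

theory Defs
  imports Complex_Main "HOL-Combinatorics.Permutations"
begin

definition \<omega> :: complex where
  "\<omega> = exp (2 * complex_of_real pi * \<i> / 3)"

text \<open>
  A directed graph without isolated vertices, 2-cell-embedded in oriented surfaces (one for each
  component), is given by its rotation system: the permutation of the edge-ends that sends every
  edge-end to the next one in clockwise order around the same vertex. The vertices are the cycles
  of this permutation.
\<close>

datatype kind = Tail | Head

record 'e dimap =
  edges :: "'e set"
  rot :: "'e \<times> kind \<Rightarrow> 'e \<times> kind"

definition ends :: "'e dimap \<Rightarrow> ('e \<times> kind) set" where
  "ends G = edges G \<times> UNIV"

definition alternating_dimap :: "'e dimap \<Rightarrow> bool" where
  "alternating_dimap G \<longleftrightarrow>
     finite (edges G) \<and> rot G permutes ends G \<and> (\<forall>d \<in> ends G. snd (rot G d) \<noteq> snd d)"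

text \<open>
  On arriving at the head of \<open>e\<close>, the face to the left of \<open>e\<close> is continued by the next edge-end
  clockwise, the face to the right of \<open>e\<close> by the next edge-end anticlockwise. An a-face lies to the
  left of its edges and a c-face to the right; so going clockwise around the face means going
  against the direction of the edges of an a-face, and along those of a c-face.
\<close>

definition left_succ :: "'e dimap \<Rightarrow> 'e \<Rightarrow> 'e" where
  "left_succ G e = fst (rot G (e, Head))"

definition right_succ :: "'e dimap \<Rightarrow> 'e \<Rightarrow> 'e" where
  "right_succ G e = fst (inv (rot G) (e, Head))"

definition sigma_1 :: "'e dimap \<Rightarrow> 'e \<Rightarrow> 'e" where
  "sigma_1 G e = fst (rot G (rot G (e, Head)))"

definition sigma_\<omega> :: "'e dimap \<Rightarrow> 'e \<Rightarrow> 'e" where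
  "sigma_\<omega> G = inv (left_succ G)"

definition sigma_\<omega>2 :: "'e dimap \<Rightarrow> 'e \<Rightarrow> 'e" where
  "sigma_\<omega>2 G = right_succ G"

text \<open>\<open>remove d \<pi>\<close> takes \<open>d\<close> out of its cycle of \<open>\<pi>\<close> and leaves it as a fixed point.\<close>

definition remove :: "'a \<Rightarrow> ('a \<Rightarrow> 'a) \<Rightarrow> 'a \<Rightarrow> 'a" where
  "remove d \<pi> = (\<lambda>x. if x = d then d else if \<pi> x = d then \<pi> d else \<pi> x)"

text \<open>For a fixed point \<open>d'\<close> of \<open>\<pi>\<close>: \<open>d'\<close> takes the place of \<open>d\<close>, and \<open>d\<close> becomes a fixed point.\<close>

definition replace_by :: "'a \<Rightarrow> 'a \<Rightarrow> ('a \<Rightarrow> 'a) \<Rightarrow> 'a \<Rightarrow> 'a" where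
  "replace_by d d' \<pi> = transpose d d' \<circ> \<pi> \<circ> transpose d d'"

definition delete_edge :: "'e \<Rightarrow> ('e \<times> kind \<Rightarrow> 'e \<times> kind) \<Rightarrow> 'e \<times> kind \<Rightarrow> 'e \<times> kind" where
  "delete_edge e \<rho> = remove (e, Tail) (remove (e, Head) \<rho>)"

text \<open>
  Both ends of \<open>e\<close> are deleted, the predecessor of either one is joined to the successor of the
  other. If the ends of \<open>e\<close> lie at different vertices, this merges the two rotations
  \<open>(e, Tail), p\<^sub>1, \<dots>, p\<^sub>m\<close> and \<open>(e, Head), q\<^sub>1, \<dots>, q\<^sub>n\<close> into the single rotation
  \<open>p\<^sub>1, \<dots>, p\<^sub>m, q\<^sub>1, \<dots>, q\<^sub>n\<close>. If \<open>e\<close> is a loop, it splits the rotation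
  \<open>(e, Head), a\<^sub>1, \<dots>, b\<^sub>k, (e, Tail), c\<^sub>1, \<dots>, d\<^sub>l\<close> into \<open>a\<^sub>1, \<dots>, b\<^sub>k\<close> and \<open>c\<^sub>1, \<dots>, d\<^sub>l\<close>.
\<close>

definition splice :: "'e \<Rightarrow> ('e \<times> kind \<Rightarrow> 'e \<times> kind) \<Rightarrow> 'e \<times> kind \<Rightarrow> 'e \<times> kind" where
  "splice e \<rho> = (\<lambda>d.
     if d = (e, Head) \<or> d = (e, Tail) then d
     else if \<rho> d = (e, Tail) then \<rho> (e, Head)
     else if \<rho> d = (e, Head) then \<rho> (e, Tail)
     else \<rho> d)"

definition reduce_1 :: "'e dimap \<Rightarrow> 'e \<Rightarrow> 'e dimap" where
  "reduce_1 G e =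
     \<lparr>edges = edges G - {e},
      rot = (if left_succ G e = e \<or> right_succ G e = e then delete_edge e (rot G)
             else splice e (rot G))\<rparr>"

text \<open>
  In the other two reductions, the tail of the successor \<open>g\<close> of \<open>e\<close> leaves its place at the head
  of \<open>e\<close> and takes the place of the tail of \<open>e\<close>.
\<close>

definition reduce_\<omega> :: "'e dimap \<Rightarrow> 'e \<Rightarrow> 'e dimap" where
  "reduce_\<omega> G e =
     (let g = left_succ G e in
      \<lparr>edges = edges G - {e},
       rot = (if g = e then delete_edge e (rot G)
              else replace_by (e, Tail) (g, Tail)
                     (remove (g, Tail) (remove (e, Head) (rot G))))\<rparr>)"

definition reduce_\<omega>2 :: "'e dimap \<Rightarrow> 'e \<Rightarrow> 'e dimap" where
  "reduce_\<omega>2 G e =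
     (let f = right_succ G e in
      \<lparr>edges = edges G - {e},
       rot = (if f = e then delete_edge e (rot G)
              else replace_by (e, Tail) (f, Tail)
                     (remove (f, Tail) (remove (e, Head) (rot G))))\<rparr>)"

definition reduce :: "complex \<Rightarrow> 'e dimap \<Rightarrow> 'e \<Rightarrow> 'e dimap" where
  "reduce \<nu> G e =
     (if \<nu> = 1 then reduce_1 G e
      else if \<nu> = \<omega> then reduce_\<omega> G e
      else if \<nu> = \<omega>\<^sup>2 then reduce_\<omega>2 G e
      else undefined)"

text \<open>
  The alternating dimap on the edge set \<open>E\<close> with a-face permutation \<open>\<alpha>\<close> and c-face permutation \<open>\<gamma>\<close>;
  its in-star permutation is then \<open>inv (\<alpha> \<circ> \<gamma>)\<close>.
\<close>

definition dimap_of :: "'e set \<Rightarrow> ('e \<Rightarrow> 'e) \<Rightarrow> ('e \<Rightarrow> 'e) \<Rightarrow> 'e dimap" where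
  "dimap_of E \<alpha> \<gamma> =
     \<lparr>edges = E,
      rot = (\<lambda>(e, k). if e \<in> E then (case k of Head \<Rightarrow> (inv \<alpha> e, Tail) | Tail \<Rightarrow> (inv \<gamma> e, Head))
                      else (e, k))\<rparr>"

text \<open>
  The three permutations of the trial are the transports along \<open>t\<close> of those of \<open>G\<close>: a-faces of the
  trial come from in-stars, c-faces from a-faces, and thereby in-stars from c-faces.
  The injection \<open>t\<close> names the edges of trials: the edge \<open>e\<^sup>\<omega>\<close> is \<open>t e\<close>, and so the edge with exponent
  \<open>\<omega>\<^sup>2\<close> is \<open>t (t e)\<close>.
\<close>

definition trial :: "('e \<Rightarrow> 'e) \<Rightarrow> 'e dimap \<Rightarrow> 'e dimap" where
  "trial t G =
     dimap_of (t ` edges G)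
       (map_permutation (edges G) t (sigma_1 G))
       (map_permutation (edges G) t (sigma_\<omega> G))"

definition trial_pow :: "('e \<Rightarrow> 'e) \<Rightarrow> 'e dimap \<Rightarrow> complex \<Rightarrow> 'e dimap" where
  "trial_pow t G \<mu> =
     (if \<mu> = 1 then G
      else if \<mu> = \<omega> then trial t G
      else if \<mu> = \<omega>\<^sup>2 then trial t (trial t G)
      else undefined)"

definition edge_pow :: "('e \<Rightarrow> 'e) \<Rightarrow> 'e \<Rightarrow> complex \<Rightarrow> 'e" where
  "edge_pow t e \<mu> =
     (if \<mu> = 1 then e
      else if \<mu> = \<omega> then t e
      else if \<mu> = \<omega>\<^sup>2 then t (t e)
      else undefined)"

end

theory Submission
  imports Defs
begin

text \<open>
  An alternating dimap amounts to a triple of permutations (in-stars, a-faces, c-faces) with trivial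
  product, and each reduction removes \<open>e\<close> from the cycles of two of the three, the third being
  determined by the product. The trial permutes the three roles cyclically, so it turns each
  reduction into the next one; this settles \<open>\<mu> = \<omega>\<close>, and applying it twice settles \<open>\<mu> = \<omega>\<^sup>2\<close>.
\<close>

section \<open>Removing a point from a cycle of a permutation\<close>

lemma inv_comp_permutes:
  assumes "p permutes S" "q permutes S"
  shows "inv (p \<circ> q) = inv q \<circ> inv p"
  using assms by (simp add: o_inv_distrib permutes_bij)

lemma inv_eq_iff_permutes:
  assumes "\<pi> permutes S"
  shows "inv \<pi> x = y \<longleftrightarrow> x = \<pi> y"
  using permutes_inverses[OF assms] by metis

lemma permutesI:
  assumes "bij p" "\<And>x. x \<notin> S \<Longrightarrow> p x = x"
  shows "p permutes S"
  using assms unfolding permutes_def by (metis bij_pointE)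

lemma remove_permutes:
  assumes "\<pi> permutes S"
  shows "remove d \<pi> permutes S - {d}"
proof (rule permutesI)
  have inj: "\<pi> x = \<pi> y \<longleftrightarrow> x = y" for x y
    using assms by (metis permutes_inj injD)
  have surj: "\<exists>x. \<pi> x = y" for y
    using assms by (metis permutes_surj surjD)
  have "inj (remove d \<pi>)"
    by (rule injI) (auto simp: remove_def inj split: if_splits)
  moreover have "surj (remove d \<pi>)"
    unfolding surj_def remove_def by (metis surj)
  ultimately show "bij (remove d \<pi>)"
    by (simp add: bij_def)
  show "remove d \<pi> x = x" if "x \<notin> S - {d}" for x
    using that assms by (auto simp: remove_def inj permutes_not_in split: if_splits)
qed

text \<open>Removal bridges the gap at \<open>d\<close>: in one direction \<open>inv \<pi> d\<close>
  is sent to \<open>\<pi> d\<close>, in the other direction back. The rotation of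
  \<open>dimap_of\<close> is built from the inverses of the face permutations, so removal has to
  pass through \<open>inv\<close>.\<close>

lemma inv_remove:
  assumes "\<pi> permutes S"
  shows "inv (remove d \<pi>) = remove d (inv \<pi>)"
proof (rule inv_unique_comp)
  show "remove d \<pi> \<circ> remove d (inv \<pi>) = id"
    by (auto simp: remove_def fun_eq_iff inv_eq_iff_permutes[OF assms] permutes_inverses[OF assms]
        inj_eq[OF permutes_inj[OF assms]])
  show "remove d (inv \<pi>) \<circ> remove d \<pi> = id"
    by (auto simp: remove_def fun_eq_iff inv_eq_iff_permutes[OF assms] permutes_inverses[OF assms]
        inj_eq[OF permutes_inj[OF assms]])
qed

section \<open>Rotation systems versus pairs of face permutations\<close>

lemma dimap_of_alternating:
  assumes "finite E" "\<alpha> permutes E" "\<gamma> permutes E"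
  shows "alternating_dimap (dimap_of E \<alpha> \<gamma>)"
proof -
  let ?\<rho> = "rot (dimap_of E \<alpha> \<gamma>)"
  \<comment> \<open>The candidate inverse, one step anticlockwise: a tail was reached from a head
    through \<open>inv \<alpha>\<close>, a head from a tail through
    \<open>inv \<gamma>\<close>.\<close>
  let ?\<tau> = "\<lambda>(e, k). if e \<in> E then (case k of Tail \<Rightarrow> (\<alpha> e, Head) | Head \<Rightarrow> (\<gamma> e, Tail)) else (e, k)"
  note p = permutes_inverses[OF assms(2)] permutes_inverses[OF assms(3)]
    permutes_in_image[OF assms(2)] permutes_in_image[OF assms(3)]
    permutes_in_image[OF permutes_inv[OF assms(2)]] permutes_in_image[OF permutes_inv[OF assms(3)]]
  have "?\<rho> permutes E \<times> UNIV"
  proof (rule permutesI)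
    show "bij ?\<rho>"
      by (rule o_bij[of ?\<tau>]) (auto simp: dimap_of_def fun_eq_iff p split: kind.splits)
    show "?\<rho> x = x" if "x \<notin> E \<times> UNIV" for x
      using that by (auto simp: dimap_of_def split: prod.splits if_splits)
  qed
  then show ?thesis
    using assms(1)
    by (auto simp: alternating_dimap_def ends_def dimap_of_def split: kind.splits)
qed

lemma inv_rot_dimap_of:
  assumes "finite E" "\<alpha> permutes E" "\<gamma> permutes E" "x \<in> E"
  shows "inv (rot (dimap_of E \<alpha> \<gamma>)) (x, Head) = (\<gamma> x, Tail)"
proof -
  have "bij (rot (dimap_of E \<alpha> \<gamma>))"
    using dimap_of_alternating[OF assms(1-3)] permutes_bij unfolding alternating_dimap_def by blast
  moreover have "rot (dimap_of E \<alpha> \<gamma>) (\<gamma> x, Tail) = (x, Head)"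
    using assms by (simp add: dimap_of_def permutes_inverses permutes_in_image)
  ultimately show ?thesis
    by (metis bij_inv_eq_iff)
qed

lemma edges_dimap_of [simp]: "edges (dimap_of E \<alpha> \<gamma>) = E"
  by (simp add: dimap_of_def)

lemma left_succ_dimap_of:
  assumes "\<alpha> permutes E"
  shows "left_succ (dimap_of E \<alpha> \<gamma>) = inv \<alpha>"
  using permutes_not_in[OF permutes_inv[OF assms]]
  by (auto simp: left_succ_def dimap_of_def fun_eq_iff)

lemma rot_dimap_of_outside:
  "x \<notin> E \<Longrightarrow> rot (dimap_of E \<alpha> \<gamma>) (x, k) = (x, k)"
  by (simp add: dimap_of_def)

lemma right_succ_dimap_of:
  assumes "finite E" "\<alpha> permutes E" "\<gamma> permutes E"
  shows "right_succ (dimap_of E \<alpha> \<gamma>) = \<gamma>"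
proof
  fix x
  show "right_succ (dimap_of E \<alpha> \<gamma>) x = \<gamma> x"
  proof (cases "x \<in> E")
    case True
    then show ?thesis
      using inv_rot_dimap_of[OF assms] by (simp add: right_succ_def)
  next
    case False
    moreover have "bij (rot (dimap_of E \<alpha> \<gamma>))"
      using dimap_of_alternating[OF assms] permutes_bij unfolding alternating_dimap_def by blast
    ultimately have "inv (rot (dimap_of E \<alpha> \<gamma>)) (x, Head) = (x, Head)"
      by (metis (no_types, lifting) bij_inv_eq_iff rot_dimap_of_outside)
    then show ?thesis
      using False permutes_not_in[OF assms(3)] by (simp add: right_succ_def)
  qed
qed

lemma sigma_dimap_of:
  assumes "finite E" "\<alpha> permutes E" "\<gamma> permutes E"
  shows "sigma_1 (dimap_of E \<alpha> \<gamma>) = inv \<gamma> \<circ> inv \<alpha>"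
    and "sigma_\<omega> (dimap_of E \<alpha> \<gamma>) = \<alpha>"
proof -
  show "sigma_1 (dimap_of E \<alpha> \<gamma>) = inv \<gamma> \<circ> inv \<alpha>"
    \<comment> \<open>The first clockwise step applies \<open>inv \<alpha>\<close> and lands on a
      tail, the second applies \<open>inv \<gamma>\<close> and lands on the next head. Off
      \<open>E\<close> both sides are the identity, so the equation holds on the whole type.\<close>
    using permutes_not_in[OF permutes_inv[OF assms(2)]] permutes_not_in[OF permutes_inv[OF assms(3)]]
      permutes_in_image[OF permutes_inv[OF assms(2)]]
    by (auto simp: sigma_1_def dimap_of_def fun_eq_iff)
  show "sigma_\<omega> (dimap_of E \<alpha> \<gamma>) = \<alpha>"
    using assms by (simp add: sigma_\<omega>_def left_succ_dimap_of permutes_inv_inv)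
qed

text \<open>Alternation makes the rotation exchange heads and tails, so it splits into two maps of
  edges, \<open>l\<close> on heads and \<open>r\<close> on tails; their inverses are the face
  permutations. Every alternating dimap can thus be computed with in the form
  \<open>dimap_of\<close>.\<close>

lemma alternating_dimapE:
  assumes "alternating_dimap G"
  obtains \<alpha> \<gamma> where "finite (edges G)" "\<alpha> permutes edges G" "\<gamma> permutes edges G"
    "G = dimap_of (edges G) \<alpha> \<gamma>"
proof -
  define E where "E = edges G"
  define \<rho> where "\<rho> = rot G"
  define l where "l = (\<lambda>x. fst (\<rho> (x, Head)))"
  define r where "r = (\<lambda>x. fst (\<rho> (x, Tail)))"
  have fin: "finite E" and per: "\<rho> permutes E \<times> UNIV"
    and alt: "\<And>x k. x \<in> E \<Longrightarrow> snd (\<rho> (x, k)) \<noteq> k"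
    using assms by (auto simp: alternating_dimap_def ends_def E_def \<rho>_def)
  have \<rho>: "\<rho> (x, Head) = (l x, Tail)" "\<rho> (x, Tail) = (r x, Head)" if "x \<in> E" for x
    using alt[OF that] by (metis l_def r_def kind.exhaust prod.collapse)+
  have out: "\<rho> (x, k) = (x, k)" if "x \<notin> E" for x k
    using permutes_not_in[OF per] that by simp
  have inj: "\<rho> d = \<rho> d' \<longleftrightarrow> d = d'" for d d'
    using per by (metis permutes_inj injD)
  have mem: "l x \<in> E" "r x \<in> E" if "x \<in> E" for x
    using permutes_in_image[OF per, of "(x, Head)"] permutes_in_image[OF per, of "(x, Tail)"] \<rho> that
    by auto
  have "inj_on l E" "inj_on r E"
    using \<rho> inj by (metis inj_onI prod.inject)+
  \<comment> \<open>Surjectivity comes from injectivity and the finiteness of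
    \<open>E\<close>.\<close>
  then have "bij_betw l E E" "bij_betw r E E"
    using mem fin by (simp_all add: bij_betw_def endo_inj_surj image_subset_iff)
  then have l: "l permutes E" and r: "r permutes E"
    using out by (auto intro!: bij_imp_permutes simp: l_def r_def)
  have "rot (dimap_of E (inv l) (inv r)) = \<rho>"
    using \<rho> out l r by (auto simp: dimap_of_def fun_eq_iff permutes_inv_inv split: kind.splits)
  then have "G = dimap_of E (inv l) (inv r)"
    by (simp add: E_def \<rho>_def)
  then show thesis
    using that fin l r permutes_inv unfolding E_def by blast
qed

section \<open>The three reductions as operations on permutations\<close>

lemma reduce_1_dimap_of:
  assumes "finite E" "\<alpha> permutes E" "\<gamma> permutes E" "e \<in> E"
  shows "reduce_1 (dimap_of E \<alpha> \<gamma>) e = dimap_of (E - {e}) (remove e \<alpha>) (remove e \<gamma>)"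
proof -
  note p = permutes_inverses[OF assms(2)] permutes_inverses[OF assms(3)]
    permutes_in_image[OF assms(2)] permutes_in_image[OF assms(3)]
    permutes_in_image[OF permutes_inv[OF assms(2)]] permutes_in_image[OF permutes_inv[OF assms(3)]]
  have iff: "inv \<alpha> x = y \<longleftrightarrow> x = \<alpha> y" "inv \<gamma> x = y \<longleftrightarrow> x = \<gamma> y" for x y
    using assms(2,3) by (simp_all add: inv_eq_iff_permutes)
  have inj: "\<alpha> x = \<alpha> y \<longleftrightarrow> x = y" "\<gamma> x = \<gamma> y \<longleftrightarrow> x = y" for x y
    using assms(2,3) by (simp_all add: permutes_inj inj_eq)
  \<comment> \<open>This fact and the next serve the branch \<open>delete_edge\<close>, where
    \<open>e\<close> alone forms an a-face or a c-face.\<close>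
  have fixed: "inv \<alpha> e = e" if "\<alpha> e = e"
    using that iff by metis
  have fixed': "inv \<gamma> e = e" if "\<gamma> e = e"
    using that iff by metis
  \<comment> \<open>The predecessor of the tail of \<open>e\<close> is the head of
    \<open>\<alpha> e\<close>, and splicing sends it to the tail of \<open>inv \<alpha> e\<close>:
    this takes \<open>e\<close> out of its a-face. The predecessor of the head of \<open>e\<close>
    does the same for the c-face.\<close>
  have "rot (reduce_1 (dimap_of E \<alpha> \<gamma>) e) (x, k) =
    rot (dimap_of (E - {e}) (remove e \<alpha>) (remove e \<gamma>)) (x, k)" for x k
    unfolding reduce_1_def left_succ_dimap_of[OF assms(2)] right_succ_dimap_of[OF assms(1-3)]
    unfolding dimap_of_def inv_remove[OF assms(2)] inv_remove[OF assms(3)]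
    using assms(4) fixed fixed'
    by (cases k) (auto simp: delete_edge_def splice_def remove_def iff inj p)
  then show ?thesis
    by (auto simp: reduce_1_def fun_eq_iff intro!: dimap.equality)
qed

text \<open>In the next two lemmas, \<open>inv \<gamma> \<circ> inv \<alpha>\<close> is the in-star permutation \<open>sigma_1\<close>.\<close>

lemma reduce_\<omega>_dimap_of:
  assumes "finite E" "\<alpha> permutes E" "\<gamma> permutes E" "e \<in> E"
  shows "reduce_\<omega> (dimap_of E \<alpha> \<gamma>) e =
    dimap_of (E - {e}) (remove e \<alpha>) (inv (remove e (inv \<gamma> \<circ> inv \<alpha>) \<circ> remove e \<alpha>))"
    (is "_ = ?H")
proof -
  let ?\<sigma> = "inv \<gamma> \<circ> inv \<alpha>"
  note p = permutes_inverses[OF assms(2)] permutes_inverses[OF assms(3)]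
    permutes_in_image[OF assms(2)] permutes_in_image[OF assms(3)]
    permutes_in_image[OF permutes_inv[OF assms(2)]] permutes_in_image[OF permutes_inv[OF assms(3)]]
  have iff: "inv \<alpha> x = y \<longleftrightarrow> x = \<alpha> y" "inv \<gamma> x = y \<longleftrightarrow> x = \<gamma> y"
    "y = inv \<alpha> x \<longleftrightarrow> x = \<alpha> y" for x y
    using assms(2,3) by (auto simp: inv_eq_iff_permutes permutes_inverses)
  have inj: "\<alpha> x = \<alpha> y \<longleftrightarrow> x = y" "\<gamma> x = \<gamma> y \<longleftrightarrow> x = y" for x y
    using assms(2,3) by (simp_all add: permutes_inj inj_eq)
  \<comment> \<open>The rotation of \<open>?H\<close> inverts a c-face permutation that is itself
    given as an inverse; \<open>q\<close> cancels the two.\<close>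
  have "remove e ?\<sigma> \<circ> remove e \<alpha> permutes E - {e}"
    by (intro permutes_compose remove_permutes permutes_inv assms)
  then have q: "inv (inv (remove e ?\<sigma> \<circ> remove e \<alpha>)) = remove e ?\<sigma> \<circ> remove e \<alpha>"
    by (rule permutes_inv_inv)
  \<comment> \<open>The remaining heads keep their cyclic order around each vertex, whence
    \<open>remove e ?\<sigma>\<close>. If \<open>g\<close> differs from \<open>e\<close>, its tail
    now follows the head of \<open>\<alpha> e\<close>, whence
    \<open>remove e \<alpha>\<close>.\<close>
  have "rot (reduce_\<omega> (dimap_of E \<alpha> \<gamma>) e) (x, k) = rot ?H (x, k)" for x k
    unfolding reduce_\<omega>_def left_succ_dimap_of[OF assms(2)]
    unfolding dimap_of_def inv_remove[OF assms(2)] q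
    using assms(4)
    by (cases k) (auto simp: Let_def delete_edge_def replace_by_def transpose_def remove_def iff inj p)
  then show ?thesis
    by (auto simp: reduce_\<omega>_def Let_def fun_eq_iff intro!: dimap.equality)
qed

lemma reduce_\<omega>2_dimap_of:
  assumes "finite E" "\<alpha> permutes E" "\<gamma> permutes E" "e \<in> E"
  shows "reduce_\<omega>2 (dimap_of E \<alpha> \<gamma>) e =
    dimap_of (E - {e}) (inv (remove e \<gamma> \<circ> remove e (inv \<gamma> \<circ> inv \<alpha>))) (remove e \<gamma>)"
    (is "_ = ?H")
proof -
  let ?\<sigma> = "inv \<gamma> \<circ> inv \<alpha>"
  note p = permutes_inverses[OF assms(2)] permutes_inverses[OF assms(3)]
    permutes_in_image[OF assms(2)] permutes_in_image[OF assms(3)]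
    permutes_in_image[OF permutes_inv[OF assms(2)]] permutes_in_image[OF permutes_inv[OF assms(3)]]
  have iff: "inv \<alpha> x = y \<longleftrightarrow> x = \<alpha> y" "inv \<gamma> x = y \<longleftrightarrow> x = \<gamma> y" for x y
    using assms(2,3) by (simp_all add: inv_eq_iff_permutes)
  have inj: "\<alpha> x = \<alpha> y \<longleftrightarrow> x = y" "\<gamma> x = \<gamma> y \<longleftrightarrow> x = y" for x y
    using assms(2,3) by (simp_all add: permutes_inj inj_eq)
  have "remove e \<gamma> \<circ> remove e ?\<sigma> permutes E - {e}"
    by (intro permutes_compose remove_permutes permutes_inv assms)
  then have q: "inv (inv (remove e \<gamma> \<circ> remove e ?\<sigma>)) = remove e \<gamma> \<circ> remove e ?\<sigma>"
    by (rule permutes_inv_inv)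
  \<comment> \<open>Again the order of the remaining heads survives. If \<open>f\<close> differs
    from \<open>e\<close>, its tail now precedes the head of \<open>inv \<gamma> e\<close>, which
    takes \<open>e\<close> out of its c-face.\<close>
  have "rot (reduce_\<omega>2 (dimap_of E \<alpha> \<gamma>) e) (x, k) = rot ?H (x, k)" for x k
    unfolding reduce_\<omega>2_def right_succ_dimap_of[OF assms(1-3)]
    unfolding dimap_of_def inv_remove[OF assms(3)] q
    using assms(4)
    by (cases k) (auto simp: Let_def delete_edge_def replace_by_def transpose_def remove_def iff inj p)
  then show ?thesis
    by (auto simp: reduce_\<omega>2_def Let_def fun_eq_iff intro!: dimap.equality)
qed

section \<open>Transport along \<open>t\<close>, and reductions of trials\<close>

lemma map_permutation_remove:
  assumes "inj t" "\<pi> permutes E" "e \<in> E"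
  shows "map_permutation (E - {e}) t (remove e \<pi>) = remove (t e) (map_permutation E t \<pi>)"
proof
  fix y
  show "map_permutation (E - {e}) t (remove e \<pi>) y = remove (t e) (map_permutation E t \<pi>) y"
  proof (cases "y \<in> t ` E")
    case True
    then obtain x where x: "x \<in> E" "y = t x" by blast
    have inj: "inj_on t A" for A
      using assms(1) inj_on_subset by blast
    \<comment> \<open>By injectivity \<open>t e\<close> lies outside the image of
      \<open>E - {e}\<close>, where \<open>map_permutation\<close> is the identity; this agrees with
      the fixed point that \<open>remove\<close> leaves.\<close>
    have "map_permutation (E - {e}) t (remove e \<pi>) (t e) = t e"
      using assms(1) by (auto simp: map_permutation_def restrict_id_def inj_eq)
    then show ?thesis
      using x assms(1,3) map_permutation_apply[OF inj, of _ E] map_permutation_apply[OF inj, of x "E - {e}"]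
      by (auto simp: remove_def inj_eq)
  next
    case False
    then show ?thesis
      using assms(3) by (auto simp: map_permutation_def remove_def restrict_id_def)
  qed
qed

lemma map_permutation_inv:
  assumes "inj t" "\<pi> permutes E"
  shows "map_permutation E t (inv \<pi>) = inv (map_permutation E t \<pi>)"
proof -
  have inj: "inj_on t E"
    using assms(1) inj_on_subset by blast
  have "map_permutation E t \<pi> \<circ> map_permutation E t (inv \<pi>) = id"
    "map_permutation E t (inv \<pi>) \<circ> map_permutation E t \<pi> = id"
    using map_permutation_compose'[OF inj] assms(2)
    by (metis map_permutation_id'[OF inj] permutes_inv permutes_inv_o)+
  then show ?thesis
    by (metis inv_unique_comp)
qed

lemma map_permutation_permutes_image:
  assumes "inj t" "\<pi> permutes E"
  shows "map_permutation E t \<pi> permutes t ` E"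
  using assms by (intro map_permutation_permutes) (auto simp: bij_betw_def intro: inj_on_subset)

lemma trial_dimap_of:
  assumes "finite E" "\<alpha> permutes E" "\<gamma> permutes E"
  shows "trial t (dimap_of E \<alpha> \<gamma>) =
    dimap_of (t ` E) (map_permutation E t (inv \<gamma> \<circ> inv \<alpha>)) (map_permutation E t \<alpha>)"
  using assms by (simp add: trial_def sigma_dimap_of)

text \<open>Needed to apply \<open>reduce_trial\<close> a second time, to the trial itself.\<close>

lemma trial_alternating:
  assumes "alternating_dimap G" "inj t"
  shows "alternating_dimap (trial t G)"
proof -
  obtain \<alpha> \<gamma> where G: "finite (edges G)" "\<alpha> permutes edges G" "\<gamma> permutes edges G"
    "G = dimap_of (edges G) \<alpha> \<gamma>"
    using assms(1) by (rule alternating_dimapE)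
  have "alternating_dimap (trial t (dimap_of (edges G) \<alpha> \<gamma>))"
    unfolding trial_dimap_of[OF G(1-3)] using G(1-3) assms(2)
    by (intro dimap_of_alternating map_permutation_permutes_image permutes_compose permutes_inv) auto
  then show ?thesis
    using G(4) by simp
qed

text \<open>In-stars, a-faces and c-faces of the trial are c-faces, in-stars and a-faces of
  \<open>G\<close>. So the pair of permutations from which a reduction of the trial removes
  \<open>t e\<close> is the pair treated by the reduction of \<open>G\<close> on the right.\<close>

lemma reduce_trial:
  assumes "alternating_dimap G" "e \<in> edges G" "inj t"
  shows "reduce_1 (trial t G) (t e) = trial t (reduce_\<omega> G e)"
    and "reduce_\<omega> (trial t G) (t e) = trial t (reduce_\<omega>2 G e)"
    and "reduce_\<omega>2 (trial t G) (t e) = trial t (reduce_1 G e)"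
proof -
  obtain \<alpha> \<gamma> where G': "finite (edges G)" "\<alpha> permutes edges G" "\<gamma> permutes edges G"
    "G = dimap_of (edges G) \<alpha> \<gamma>"
    using assms(1) by (rule alternating_dimapE)
  define E where "E = edges G"
  note G = G'[folded E_def]
  have e: "e \<in> E" "t e \<in> t ` E" and fin: "finite (E - {e})" "finite (t ` E)"
    using assms(2) G(1) by (auto simp: E_def)
  have img: "t ` E - {t e} = t ` (E - {e})"
    using assms(3) by (auto simp: inj_eq)
  define \<sigma> where "\<sigma> = inv \<gamma> \<circ> inv \<alpha>"
  have \<sigma>: "\<sigma> permutes E"
    unfolding \<sigma>_def by (intro permutes_compose permutes_inv G)
  define T where "T = map_permutation E t"
  have T: "T \<pi> permutes t ` E" if "\<pi> permutes E" for \<pi>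
    unfolding T_def using assms(3) that by (rule map_permutation_permutes_image)
  have inv\<sigma>: "inv \<sigma> = \<alpha> \<circ> \<gamma>"
    unfolding \<sigma>_def using inv_comp_permutes[OF permutes_inv permutes_inv, OF G(3,2)] G(2,3)
    by (simp add: permutes_inv_inv)
  \<comment> \<open>The in-star permutation of the trial, forced by the product identity.\<close>
  have third: "inv (T \<alpha>) \<circ> inv (T \<sigma>) = T \<gamma>"
  proof -
    have "inv (T \<alpha>) \<circ> inv (T \<sigma>) = T (inv \<alpha> \<circ> inv \<sigma>)"
      unfolding T_def using assms(3) G \<sigma> inj_on_subset[of t UNIV E]
      by (simp add: map_permutation_inv map_permutation_compose' permutes_inv)
    also have "inv \<alpha> \<circ> inv \<sigma> = \<gamma>"
      unfolding inv\<sigma> using permutes_inv_o(2)[OF G(2)] by (simp flip: o_assoc add: comp_assoc[symmetric])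
    finally show ?thesis .
  qed
  have R: "remove (t e) (T \<pi>) = map_permutation (E - {e}) t (remove e \<pi>)" if "\<pi> permutes E" for \<pi>
    unfolding T_def using map_permutation_remove[OF assms(3) that e(1)] by simp
  \<comment> \<open>Transport also commutes with forming the third permutation after
    \<open>e\<close> is gone.\<close>
  have C: "inv (map_permutation (E - {e}) t \<pi> \<circ> map_permutation (E - {e}) t \<rho>) =
      map_permutation (E - {e}) t (inv (\<pi> \<circ> \<rho>))"
    if "\<pi> permutes E - {e}" "\<rho> permutes E - {e}" for \<pi> \<rho>
    using that assms(3) inj_on_subset[of t UNIV "E - {e}"]
    by (simp add: map_permutation_inv permutes_compose flip: map_permutation_compose')
  note rem = remove_permutes[OF G(2), of e] remove_permutes[OF G(3), of e] remove_permutes[OF \<sigma>, of e]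
  have invs: "inv (inv (p \<circ> q)) = p \<circ> q" if "p permutes S" "q permutes S" for p q and S :: "'a set"
    using that by (intro permutes_inv_inv permutes_compose)
  \<comment> \<open>Used to see that \<open>G\<close> reduced by \<omega> or its square has in-star
    permutation \<open>remove e \<sigma>\<close>, although its face permutations are given through
    composites.\<close>
  have cancel: "p \<circ> q \<circ> inv q = p" "inv p \<circ> (p \<circ> q) = q" if "p permutes S" "q permutes S"
    for p q and S :: "'a set"
    using that by (auto simp: fun_eq_iff permutes_inverses)
  have trialG: "trial t G = dimap_of (t ` E) (T \<sigma>) (T \<alpha>)"
    by (subst G(4)) (simp add: trial_dimap_of[OF G(1-3)] T_def \<sigma>_def)
  note tr = trialG reduce_1_dimap_of[OF fin(2) T[OF \<sigma>] T[OF G(2)] e(2)]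
    reduce_\<omega>_dimap_of[OF fin(2) T[OF \<sigma>] T[OF G(2)] e(2)]
    reduce_\<omega>2_dimap_of[OF fin(2) T[OF \<sigma>] T[OF G(2)] e(2)]
    third R[OF \<sigma>] R[OF G(2)] R[OF G(3)] C[OF rem(2) rem(3)] C[OF rem(1) rem(2)] img
  have red: "reduce_1 G e = dimap_of (E - {e}) (remove e \<alpha>) (remove e \<gamma>)"
    "reduce_\<omega> G e = dimap_of (E - {e}) (remove e \<alpha>) (inv (remove e \<sigma> \<circ> remove e \<alpha>))"
    "reduce_\<omega>2 G e = dimap_of (E - {e}) (inv (remove e \<gamma> \<circ> remove e \<sigma>)) (remove e \<gamma>)"
    using reduce_1_dimap_of[OF G(1-3) e(1)] reduce_\<omega>_dimap_of[OF G(1-3) e(1)]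
      reduce_\<omega>2_dimap_of[OF G(1-3) e(1)]
    unfolding \<sigma>_def by (simp_all flip: G(4))
  note perms = rem permutes_compose[OF rem(1) rem(3), THEN permutes_inv]
    permutes_compose[OF rem(3) rem(2), THEN permutes_inv]
  show "reduce_1 (trial t G) (t e) = trial t (reduce_\<omega> G e)"
    unfolding tr red trial_dimap_of[OF fin(1) perms(1,4)]
    by (simp only: invs[OF rem(3,1)] cancel(1)[OF rem(3,1)])
  show "reduce_\<omega> (trial t G) (t e) = trial t (reduce_\<omega>2 G e)"
    unfolding tr red trial_dimap_of[OF fin(1) perms(5,2)]
    by (simp only: invs[OF rem(2,3)] cancel(2)[OF rem(2,3)])
  show "reduce_\<omega>2 (trial t G) (t e) = trial t (reduce_1 G e)"
    unfolding tr red trial_dimap_of[OF fin(1) perms(1,2)]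
    by (simp only: inv_comp_permutes[OF rem(1,2)])
qed

section \<open>Powers of \<omega> and the final case analysis\<close>

lemma \<omega>_powers: "\<omega> \<noteq> 1" "\<omega>\<^sup>2 \<noteq> 1" "\<omega>\<^sup>2 \<noteq> \<omega>" "\<omega> ^ 3 = 1"
proof -
  have "\<omega> = cis (2 * pi / 3)"
    by (simp add: \<omega>_def cis_conv_exp mult_ac)
  \<comment> \<open>In coordinates all four claims are arithmetic. The inequalities make the case
    distinctions in \<open>reduce\<close>, \<open>trial_pow\<close> and \<open>edge_pow\<close>
    select the intended branch.\<close>
  then have \<omega>: "\<omega> = Complex (- 1 / 2) (sqrt 3 / 2)"
    by (simp add: cis.ctr cos_120 sin_120 complex_eq_iff)
  show "\<omega> \<noteq> 1" "\<omega>\<^sup>2 \<noteq> 1" "\<omega>\<^sup>2 \<noteq> \<omega>" "\<omega> ^ 3 = 1"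
    by (auto simp: \<omega> complex_eq_iff power2_eq_square power3_eq_cube)
qed

theorem theorem4:
  fixes G :: "'e dimap" and e :: 'e and t :: "'e \<Rightarrow> 'e" and \<mu> \<nu> :: complex
  assumes "alternating_dimap G"
    and "e \<in> edges G"
    and "inj t"
    and "\<mu> \<in> {1, \<omega>, \<omega>\<^sup>2}"
    and "\<nu> \<in> {1, \<omega>, \<omega>\<^sup>2}"
  shows "reduce \<nu> (trial_pow t G \<mu>) (edge_pow t e \<mu>) = trial_pow t (reduce (\<mu> * \<nu>) G e) \<mu>"
proof -
  have \<omega>: "\<omega> ^ 4 = \<omega>" "\<omega> \<noteq> 0" "\<omega> * \<omega> = \<omega>\<^sup>2"
    using \<omega>_powers(4) by (auto simp: eval_nat_numeral)
  have "t e \<in> edges (trial t G)"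
    using assms(2) by (simp add: trial_def)
  \<comment> \<open>The equations for \<open>G\<close> settle one trial. Those for
    \<open>trial t G\<close> and its edge \<open>t e\<close> pull a reduction of the double trial
    back one level, after which the first three finish.\<close>
  note r = reduce_trial[OF assms(1-3)]
    reduce_trial[OF trial_alternating[OF assms(1,3)] this assms(3)]
  show ?thesis
    using assms(4,5) \<omega>_powers(1-3)[symmetric]
    by (auto simp: trial_pow_def edge_pow_def reduce_def \<omega> \<omega>_powers r
        simp flip: power_Suc power_Suc2 power_add)
qed

end
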